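(* Let $(\mathcal V^1_{WP}\oplus\mathcal V^2_{\dot W\dot P})\leftrightarrow\mathcal V_{W\dot WM_uM_y}=\mathcal V_{P\dot PM_uM_y}$ and let $\mathcal V^1_{WP}\times W\subseteq\mathcal V_{W\dot WM_uM_y}\circ W\dot WM_u\times W$. Let $\mathcal V_{WM_u}$ be a linear subspace of vectors on $W\uplus M_u$ and let $\mathcal V_{PM_u}:=\mathcal V_{WM_u}\leftrightarrow\mathcal V^1_{WP}$. Let $\mathcal V_{W\dot W}:=(\mathcal V_{W\dot WM_uM_y}\cap\mathcal V_{WM_u})\circ W\dot W$ and $\mathcal V_{P\dot P}:=(\mathcal V_{P\dot PM_uM_y}\cap\mathcal V_{PM_u})\circ P\dot P$. Then $$(\mathcal V^1_{WP}\oplus\mathcal V^2_{\dot W\dot P})\leftrightarrow\mathcal V_{W\dot W}=\mathcal V_{P\dot P}.$$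
   Context: Fix a field $\mathbb F$; all index sets are finite. A vector on $X$ is a function $X\to\mathbb F$. $W,\dot W$ are disjoint copies of each other (in bijection), $P,\dot P$ likewise, and $W,\dot W,P,\dot P,M_u,M_y$ are pairwise disjoint. $\mathcal V_{W\dot WM_uM_y}$, $\mathcal V_{P\dot PM_uM_y}$, $\mathcal V^1_{WP}$, $\mathcal V^2_{\dot W\dot P}$ denote linear subspaces of vectors on the indicated disjoint unions. For $T\subseteq S$: $\mathcal V_S\circ T$ is the set of restrictions to $T$ of vectors in $\mathcal V_S$; $\mathcal V_S\times T:=\{f_T:(f_T,0_{S\setminus T})\in\mathcal V_S\}$; such operations are applied left to right. For spaces on sets $X,Y$: $\mathcal V_X\cap\mathcal V_Y$ is the set of vectors on $X\cup Y$ whose restrictions to $X$, $Y$ lie in $\mathcal V_X$, $\mathcal V_Y$; $\mathcal V_X\leftrightarrow\mathcal V_Y$ is the space on $(X\setminus Y)\uplus(Y\setminus X)$ of all $(g_{X\setminus Y},h_{Y\setminus X})$ with $g\in\mathcal V_X$, $h\in\mathcal V_Y$ and $g,h$ equal on $X\cap Y$. $\oplus$ is the direct sum over disjoint index sets. *)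

theory Defs
  imports Main "HOL-Library.FuncSet"
begin

text \<open>
  A vector on \<open>X\<close> is an extensional function \<open>X \<rightarrow>\<^sub>E UNIV\<close>.  Spaces are sets of such functions;
  the operations below take the index sets of their arguments explicitly.
\<close>

abbreviation vectors :: "'i set \<Rightarrow> ('i \<Rightarrow> 'a) set" where
  "vectors X \<equiv> X \<rightarrow>\<^sub>E UNIV"

definition linear_subspace :: "'i set \<Rightarrow> ('i \<Rightarrow> 'a::field) set \<Rightarrow> bool" where
  "linear_subspace X V \<longleftrightarrow>
     V \<subseteq> vectors X \<and>
     (\<lambda>i\<in>X. 0) \<in> V \<and>
     (\<forall>f\<in>V. \<forall>g\<in>V. (\<lambda>i\<in>X. f i + g i) \<in> V) \<and>
     (\<forall>c. \<forall>f\<in>V. (\<lambda>i\<in>X. c * f i) \<in> V)"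

text \<open>\<open>glue X f Y g\<close> is the vector \<open>(f\<^sub>X, g\<^sub>Y)\<close> on \<open>X \<union> Y\<close>; it is only used for disjoint \<open>X\<close>, \<open>Y\<close>.\<close>

definition glue :: "'i set \<Rightarrow> ('i \<Rightarrow> 'a) \<Rightarrow> 'i set \<Rightarrow> ('i \<Rightarrow> 'a) \<Rightarrow> 'i \<Rightarrow> 'a" where
  "glue X f Y g = (\<lambda>i\<in>X \<union> Y. if i \<in> X then f i else g i)"

text \<open>\<open>V \<circ> T\<close>\<close>

definition restriction :: "('i \<Rightarrow> 'a) set \<Rightarrow> 'i set \<Rightarrow> ('i \<Rightarrow> 'a) set" where
  "restriction V T = (\<lambda>f. restrict f T) ` V"

text \<open>\<open>V \<times> T\<close>, for \<open>V\<close> a space on \<open>S \<supseteq> T\<close>\<close>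

definition contraction :: "'i set \<Rightarrow> ('i \<Rightarrow> 'a::field) set \<Rightarrow> 'i set \<Rightarrow> ('i \<Rightarrow> 'a) set" where
  "contraction S V T = {f \<in> vectors T. glue T f (S - T) (\<lambda>_. 0) \<in> V}"

text \<open>\<open>V\<^sub>X \<inter> V\<^sub>Y\<close>, a space on \<open>X \<union> Y\<close>\<close>

definition intersection ::
  "'i set \<Rightarrow> ('i \<Rightarrow> 'a) set \<Rightarrow> 'i set \<Rightarrow> ('i \<Rightarrow> 'a) set \<Rightarrow> ('i \<Rightarrow> 'a) set" where
  "intersection X VX Y VY = {f \<in> vectors (X \<union> Y). restrict f X \<in> VX \<and> restrict f Y \<in> VY}"

text \<open>\<open>V\<^sub>X \<leftrightarrow> V\<^sub>Y\<close>, a space on \<open>(X - Y) \<union> (Y - X)\<close>\<close>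

definition matched_composition ::
  "'i set \<Rightarrow> ('i \<Rightarrow> 'a) set \<Rightarrow> 'i set \<Rightarrow> ('i \<Rightarrow> 'a) set \<Rightarrow> ('i \<Rightarrow> 'a) set" where
  "matched_composition X VX Y VY =
     {glue (X - Y) g (Y - X) h | g h. g \<in> VX \<and> h \<in> VY \<and> (\<forall>i\<in>X \<inter> Y. g i = h i)}"

text \<open>\<open>V\<^sub>X \<oplus> V\<^sub>Y\<close>, for disjoint \<open>X\<close>, \<open>Y\<close>\<close>

definition direct_sum ::
  "'i set \<Rightarrow> ('i \<Rightarrow> 'a) set \<Rightarrow> 'i set \<Rightarrow> ('i \<Rightarrow> 'a) set \<Rightarrow> ('i \<Rightarrow> 'a) set" where
  "direct_sum X VX Y VY = {glue X f Y g | f g. f \<in> VX \<and> g \<in> VY}"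

end

theory Submission imports Defs begin

text \<open>
  Every space in the statement is obtained from \<open>V1_WP\<close>, \<open>V2_W'P'\<close>, \<open>V_WW'MuMy\<close> and \<open>V_WMu\<close> by
  operations that say: there is an assignment \<open>t\<close> of field elements to the indices whose
  restrictions lie in certain spaces, and the vector at hand is a restriction of \<open>t\<close>.  Unfolded
  in this way, and with assignments that agree on shared indices merged into one, a vector \<open>f\<close>
  on \<open>P \<union> P'\<close> lies in the left-hand side iff it extends to an assignment \<open>t\<close> that has
  restrictions in \<open>V1_WP\<close>, \<open>V2_W'P'\<close>, \<open>V_WW'MuMy\<close> and \<open>V_WMu\<close>.  The right-hand side asks for
  less: the condition from \<open>V_WMu\<close> may be met by a second assignment \<open>s\<close>, whose restriction to
  \<open>W \<union> P\<close> lies in \<open>V1_WP\<close> and which agrees with \<open>t\<close> on \<open>P \<union> Mu\<close> but is free to differ from it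
  on \<open>W\<close>.

  So the left-hand side is contained in the right-hand side for arbitrary sets of vectors, and the content
  is to turn a pair \<open>s\<close>, \<open>t\<close> into a single assignment.  The difference \<open>s - t\<close>, supported on \<open>W\<close>
  within \<open>W \<union> P\<close>, restricts to a member of \<open>V1_WP \<times> W\<close>.  By the hypothesis on contractions it
  extends, by zero on \<open>W' \<union> Mu\<close> and by some values on \<open>My\<close>, to a vector \<open>e \<in> V_WW'MuMy\<close>.
  Adding \<open>e\<close> to \<open>t\<close> replaces the values of \<open>t\<close> on \<open>W\<close> by those of \<open>s\<close> and otherwise changes \<open>t\<close>
  only on \<open>My\<close>, which no constraint but the one from \<open>V_WW'MuMy\<close> can see
  (lemma \<open>correct_internal_values\<close>).
\<close>

section \<open>Membership as existence of an assignment\<close>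

lemma restrict_eq_restrict_iff: "restrict t X = restrict u X \<longleftrightarrow> (\<forall>i\<in>X. t i = u i)"
  by (metis restrict_apply' restrict_ext)

lemma linear_subspace_vectors: "linear_subspace X V \<Longrightarrow> V \<subseteq> vectors X"
  by (simp add: linear_subspace_def)

text \<open>
  Assignments are total functions, so that merging two of them and passing to a smaller index set
  require no bookkeeping of domains.
\<close>

lemma mem_matched_composition_iff:
  assumes "VX \<subseteq> vectors X" "VY \<subseteq> vectors Y"
  shows "f \<in> matched_composition X VX Y VY \<longleftrightarrow>
    (\<exists>t. restrict t X \<in> VX \<and> restrict t Y \<in> VY \<and> f = restrict t ((X - Y) \<union> (Y - X)))"
proof
  assume "f \<in> matched_composition X VX Y VY"
  then obtain g h where gh: "g \<in> VX" "h \<in> VY" "\<forall>i\<in>X \<inter> Y. g i = h i"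
    and f: "f = glue (X - Y) g (Y - X) h"
    unfolding matched_composition_def by blast
  define t where "t = (\<lambda>i. if i \<in> X then g i else h i)"
  have "restrict t X = restrict g X" "restrict t Y = restrict h Y"
    using gh(3) by (auto simp: t_def restrict_eq_restrict_iff)
  moreover have "restrict g X = g" "restrict h Y = h"
    using gh assms by (auto intro: PiE_restrict)
  moreover have "f = restrict t ((X - Y) \<union> (Y - X))"
    unfolding f glue_def t_def by (auto simp: restrict_eq_restrict_iff)
  ultimately show "\<exists>t. restrict t X \<in> VX \<and> restrict t Y \<in> VY \<and> f = restrict t ((X - Y) \<union> (Y - X))"
    using gh by metis
next
  assume "\<exists>t. restrict t X \<in> VX \<and> restrict t Y \<in> VY \<and> f = restrict t ((X - Y) \<union> (Y - X))"
  then obtain t where t: "restrict t X \<in> VX" "restrict t Y \<in> VY"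
    and f: "f = restrict t ((X - Y) \<union> (Y - X))" by blast
  have "f = glue (X - Y) (restrict t X) (Y - X) (restrict t Y)"
    unfolding f glue_def by (auto simp: restrict_eq_restrict_iff)
  then show "f \<in> matched_composition X VX Y VY"
    using t unfolding matched_composition_def by force
qed

lemma restrict_mem_direct_sum_iff:
  assumes "VX \<subseteq> vectors X" "VY \<subseteq> vectors Y" "X \<inter> Y = {}"
  shows "restrict t (X \<union> Y) \<in> direct_sum X VX Y VY \<longleftrightarrow> restrict t X \<in> VX \<and> restrict t Y \<in> VY"
proof -
  have "direct_sum X VX Y VY = matched_composition X VX Y VY"
    using assms(3) by (simp add: direct_sum_def matched_composition_def Diff_triv Int_commute)
  moreover have "(X - Y) \<union> (Y - X) = X \<union> Y"
    using assms(3) by blast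
  ultimately have "restrict t (X \<union> Y) \<in> direct_sum X VX Y VY \<longleftrightarrow>
      (\<exists>u. restrict u X \<in> VX \<and> restrict u Y \<in> VY \<and> restrict t (X \<union> Y) = restrict u (X \<union> Y))"
    by (simp only: mem_matched_composition_iff[OF assms(1,2)])
  moreover have "restrict t X = restrict u X \<and> restrict t Y = restrict u Y"
    if "restrict t (X \<union> Y) = restrict u (X \<union> Y)" for u
    using that by (simp add: restrict_eq_restrict_iff)
  ultimately show ?thesis by metis
qed

lemma direct_sum_vectors: "direct_sum X VX Y VY \<subseteq> vectors (X \<union> Y)"
  by (auto simp: direct_sum_def glue_def split: if_splits)

lemma mem_restriction_intersection_iff:
  assumes "T \<subseteq> X \<union> Y"
  shows "f \<in> restriction (intersection X VX Y VY) T \<longleftrightarrow>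
    (\<exists>t. restrict t X \<in> VX \<and> restrict t Y \<in> VY \<and> f = restrict t T)"
proof
  assume "f \<in> restriction (intersection X VX Y VY) T"
  then show "\<exists>t. restrict t X \<in> VX \<and> restrict t Y \<in> VY \<and> f = restrict t T"
    unfolding restriction_def intersection_def by blast
next
  assume "\<exists>t. restrict t X \<in> VX \<and> restrict t Y \<in> VY \<and> f = restrict t T"
  then obtain t where t: "restrict t X \<in> VX" "restrict t Y \<in> VY" "f = restrict t T" by blast
  have "restrict t (X \<union> Y) \<in> intersection X VX Y VY"
    using t by (simp add: intersection_def Int_absorb1)
  moreover have "f = restrict (restrict t (X \<union> Y)) T"
    using assms t(3) by (simp add: Int_absorb1)
  ultimately show "f \<in> restriction (intersection X VX Y VY) T"
    unfolding restriction_def by blast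
qed

section \<open>Correcting the values on the eliminated indices\<close>

lemma linear_subspace_restrict_add:
  assumes "linear_subspace X V" "restrict s X \<in> V" "restrict t X \<in> V"
  shows "restrict (\<lambda>i. s i + t i) X \<in> V"
proof -
  have "(\<lambda>i\<in>X. restrict s X i + restrict t X i) \<in> V"
    using assms unfolding linear_subspace_def by blast
  moreover have "(\<lambda>i\<in>X. restrict s X i + restrict t X i) = restrict (\<lambda>i. s i + t i) X"
    by (simp add: restrict_eq_restrict_iff)
  ultimately show ?thesis by simp
qed

lemma linear_subspace_restrict_diff:
  assumes "linear_subspace X V" "restrict s X \<in> V" "restrict t X \<in> V"
  shows "restrict (\<lambda>i. s i - t i) X \<in> V"
proof -
  have "(\<lambda>i\<in>X. - 1 * restrict t X i) \<in> V"
    using assms unfolding linear_subspace_def by blast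
  moreover have "(\<lambda>i\<in>X. - 1 * restrict t X i) = restrict (\<lambda>i. - t i) X"
    by (simp add: restrict_eq_restrict_iff)
  ultimately have "restrict (\<lambda>i. - t i) X \<in> V" by simp
  from linear_subspace_restrict_add[OF assms(1,2) this] show ?thesis by simp
qed

text \<open>
  Here \<open>W\<close> is the set of indices on which \<open>s\<close> and \<open>t\<close> may disagree, and \<open>B\<close> consists of the
  indices at which the values of \<open>t\<close> have to be preserved in \<open>V\<close>.  The values on the remaining
  indices \<open>Y - (W \<union> B)\<close> absorb the correction.
\<close>

lemma correct_internal_values:
  assumes K: "linear_subspace (W \<union> P) K" and V: "linear_subspace Y V"
    and sub: "W \<union> B \<subseteq> Y" and disj: "W \<inter> P = {}" "W \<inter> B = {}"
    and le: "contraction (W \<union> P) K W \<subseteq> contraction (W \<union> B) (restriction V (W \<union> B)) W"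
    and s: "restrict s (W \<union> P) \<in> K"
    and t: "restrict t (W \<union> P) \<in> K" "restrict t Y \<in> V"
    and agree: "\<forall>i\<in>P. s i = t i"
  obtains r where "restrict r Y \<in> V" "\<forall>i\<in>W. r i = s i" "\<forall>i\<in>B. r i = t i"
    "\<forall>i. i \<notin> Y \<longrightarrow> r i = t i"
proof -
  \<comment> \<open>Only the part of \<open>s - t\<close> on \<open>W\<close> survives, because \<open>s\<close> and \<open>t\<close> agree on \<open>P\<close>.\<close>
  define d where "d = (\<lambda>i\<in>W. s i - t i)"
  have "glue W d ((W \<union> P) - W) (\<lambda>_. 0) = restrict (\<lambda>i. s i - t i) (W \<union> P)"
    using agree by (auto simp: glue_def d_def fun_eq_iff)
  then have "d \<in> contraction (W \<union> P) K W"
    using linear_subspace_restrict_diff[OF K s t(1)] by (simp add: contraction_def d_def)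
  then have "glue W d ((W \<union> B) - W) (\<lambda>_. 0) \<in> restriction V (W \<union> B)"
    using le by (auto simp: contraction_def)
  then obtain e where "e \<in> V" and e: "restrict e (W \<union> B) = glue W d ((W \<union> B) - W) (\<lambda>_. 0)"
    unfolding restriction_def by fastforce
  have e_W: "e i = s i - t i" if "i \<in> W" for i
    using fun_cong[OF e, of i] that by (simp add: glue_def d_def)
  have e_B: "e i = 0" if "i \<in> B" for i
    using fun_cong[OF e, of i] that disj(2) by (auto simp: glue_def)
  have "restrict e Y = e"
    using \<open>e \<in> V\<close> linear_subspace_vectors[OF V] by (auto intro: PiE_restrict)
  then have te: "restrict (\<lambda>i. t i + e i) Y \<in> V"
    using linear_subspace_restrict_add[OF V t(2)] \<open>e \<in> V\<close> by metis
  define r where "r = (\<lambda>i. if i \<in> Y then t i + e i else t i)"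
  have "restrict r Y = restrict (\<lambda>i. t i + e i) Y"
    by (simp add: r_def restrict_eq_restrict_iff)
  then have "restrict r Y \<in> V"
    using te by simp
  moreover have "\<forall>i\<in>W. r i = s i" "\<forall>i\<in>B. r i = t i" "\<forall>i. i \<notin> Y \<longrightarrow> r i = t i"
    using sub e_W e_B by (auto simp: r_def)
  ultimately show thesis
    by (rule that)
qed

section \<open>Composition commutes with imposing a constraint\<close>

theorem theorem78:
  fixes W W' P P' Mu My :: "'i set"
    and dot :: "'i \<Rightarrow> 'i"
    and V1_WP V2_W'P' V_WW'MuMy V_PP'MuMy V_WMu V_PMu V_WW' V_PP' :: "('i \<Rightarrow> 'a::field) set"
  assumes finite: "finite W" "finite W'" "finite P" "finite P'" "finite Mu" "finite My"
    and copies: "bij_betw dot W W'" "bij_betw dot P P'"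
    and disjoint:
      "W \<inter> W' = {}" "W \<inter> P = {}" "W \<inter> P' = {}" "W \<inter> Mu = {}" "W \<inter> My = {}"
      "W' \<inter> P = {}" "W' \<inter> P' = {}" "W' \<inter> Mu = {}" "W' \<inter> My = {}"
      "P \<inter> P' = {}" "P \<inter> Mu = {}" "P \<inter> My = {}"
      "P' \<inter> Mu = {}" "P' \<inter> My = {}"
      "Mu \<inter> My = {}"
    and subspaces:
      "linear_subspace (W \<union> P) V1_WP"
      "linear_subspace (W' \<union> P') V2_W'P'"
      "linear_subspace (W \<union> W' \<union> Mu \<union> My) V_WW'MuMy"
      "linear_subspace (P \<union> P' \<union> Mu \<union> My) V_PP'MuMy"
    and composition:
      "matched_composition
         ((W \<union> P) \<union> (W' \<union> P')) (direct_sum (W \<union> P) V1_WP (W' \<union> P') V2_W'P')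
         (W \<union> W' \<union> Mu \<union> My) V_WW'MuMy
       = V_PP'MuMy"
    and contraction_le:
      "contraction (W \<union> P) V1_WP W
       \<subseteq> contraction (W \<union> W' \<union> Mu) (restriction V_WW'MuMy (W \<union> W' \<union> Mu)) W"
    and subspace_WMu: "linear_subspace (W \<union> Mu) V_WMu"
    and V_PMu: "V_PMu = matched_composition (W \<union> Mu) V_WMu (W \<union> P) V1_WP"
    and V_WW': "V_WW' = restriction
      (intersection (W \<union> W' \<union> Mu \<union> My) V_WW'MuMy (W \<union> Mu) V_WMu) (W \<union> W')"
    and V_PP': "V_PP' = restriction
      (intersection (P \<union> P' \<union> Mu \<union> My) V_PP'MuMy (P \<union> Mu) V_PMu) (P \<union> P')"
  shows "matched_composition
      ((W \<union> P) \<union> (W' \<union> P')) (direct_sum (W \<union> P) V1_WP (W' \<union> P') V2_W'P')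
      (W \<union> W') V_WW'
    = V_PP'"
proof (rule set_eqI)
  fix f
  let ?D = "direct_sum (W \<union> P) V1_WP (W' \<union> P') V2_W'P'"
  let ?X = "(W \<union> P) \<union> (W' \<union> P')"
  let ?Y = "W \<union> W' \<union> Mu \<union> My"
  let ?Z = "P \<union> P' \<union> Mu \<union> My"
  note vectors = subspaces[THEN linear_subspace_vectors] subspace_WMu[THEN linear_subspace_vectors]
  have sum_iff: "restrict t ?X \<in> ?D \<longleftrightarrow>
      restrict t (W \<union> P) \<in> V1_WP \<and> restrict t (W' \<union> P') \<in> V2_W'P'" for t
    using disjoint by (intro restrict_mem_direct_sum_iff vectors) (auto simp: disjoint_iff)
  have V_WW'_iff: "restrict t (W \<union> W') \<in> V_WW' \<longleftrightarrow>
      (\<exists>u. restrict u ?Y \<in> V_WW'MuMy \<and> restrict u (W \<union> Mu) \<in> V_WMu \<and>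
           (\<forall>i\<in>W \<union> W'. t i = u i))" for t
    unfolding V_WW' by (subst mem_restriction_intersection_iff) (auto simp: restrict_eq_restrict_iff)
  have V_PMu_iff: "restrict t (P \<union> Mu) \<in> V_PMu \<longleftrightarrow>
      (\<exists>s. restrict s (W \<union> Mu) \<in> V_WMu \<and> restrict s (W \<union> P) \<in> V1_WP \<and>
           (\<forall>i\<in>P \<union> Mu. t i = s i))" for t
  proof -
    have "((W \<union> Mu) - (W \<union> P)) \<union> ((W \<union> P) - (W \<union> Mu)) = P \<union> Mu"
      using disjoint by (auto simp: disjoint_iff)
    then show ?thesis
      unfolding V_PMu
      by (simp add: mem_matched_composition_iff[OF vectors(5) vectors(1)] restrict_eq_restrict_iff)
  qed
  have V_PP'MuMy_iff: "restrict t ?Z \<in> V_PP'MuMy \<longleftrightarrow>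
      (\<exists>u. restrict u (W \<union> P) \<in> V1_WP \<and> restrict u (W' \<union> P') \<in> V2_W'P' \<and>
           restrict u ?Y \<in> V_WW'MuMy \<and> (\<forall>i\<in>?Z. t i = u i))" for t
  proof -
    have "(?X - ?Y) \<union> (?Y - ?X) = ?Z"
      using disjoint by (auto simp: disjoint_iff)
    then show ?thesis
      unfolding composition[symmetric] mem_matched_composition_iff[OF direct_sum_vectors vectors(3)]
      by (simp only: sum_iff restrict_eq_restrict_iff conj_assoc)
  qed

  have "f \<in> matched_composition ?X ?D (W \<union> W') V_WW' \<longleftrightarrow>
      (\<exists>t. restrict t (W \<union> P) \<in> V1_WP \<and> restrict t (W' \<union> P') \<in> V2_W'P' \<and>
           restrict t (W \<union> W') \<in> V_WW' \<and> f = restrict t (P \<union> P'))" (is "_ \<longleftrightarrow> ?lhs")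
  proof -
    have "(?X - (W \<union> W')) \<union> ((W \<union> W') - ?X) = P \<union> P'"
      using disjoint by (auto simp: disjoint_iff)
    moreover have "V_WW' \<subseteq> vectors (W \<union> W')"
      unfolding V_WW' restriction_def by (auto split: if_splits)
    ultimately show ?thesis
      by (simp only: mem_matched_composition_iff[OF direct_sum_vectors] sum_iff conj_assoc)
  qed
  also have "\<dots> \<longleftrightarrow>
      (\<exists>t. restrict t ?Z \<in> V_PP'MuMy \<and> restrict t (P \<union> Mu) \<in> V_PMu \<and> f = restrict t (P \<union> P'))"
    (is "_ \<longleftrightarrow> ?rhs")
  proof
    assume ?lhs
    then obtain t u where t: "restrict t (W \<union> P) \<in> V1_WP" "restrict t (W' \<union> P') \<in> V2_W'P'"
        "f = restrict t (P \<union> P')"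
      and u: "restrict u ?Y \<in> V_WW'MuMy" "restrict u (W \<union> Mu) \<in> V_WMu" "\<forall>i\<in>W \<union> W'. t i = u i"
      unfolding V_WW'_iff by blast
    \<comment> \<open>The constraints on \<open>t\<close> and on \<open>u\<close> share only the indices \<open>W \<union> W'\<close>, where the two agree.\<close>
    define r where "r = (\<lambda>i. if i \<in> P \<union> P' then t i else u i)"
    have "restrict r (W \<union> P) = restrict t (W \<union> P)" "restrict r (W' \<union> P') = restrict t (W' \<union> P')"
      "restrict r ?Y = restrict u ?Y" "restrict r (W \<union> Mu) = restrict u (W \<union> Mu)"
      "restrict r (P \<union> P') = restrict t (P \<union> P')"
      using u(3) disjoint unfolding restrict_eq_restrict_iff r_def by (auto simp: disjoint_iff)
    with t u have "restrict r (W \<union> P) \<in> V1_WP" "restrict r (W' \<union> P') \<in> V2_W'P'"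
      "restrict r ?Y \<in> V_WW'MuMy" "restrict r (W \<union> Mu) \<in> V_WMu" "f = restrict r (P \<union> P')"
      by simp_all
    then show ?rhs
      unfolding V_PP'MuMy_iff V_PMu_iff by blast
  next
    assume ?rhs
    \<comment> \<open>\<open>t\<close> and \<open>s\<close> both agree with \<open>q\<close> on \<open>P \<union> Mu\<close>, but their values on \<open>W\<close> are chosen independently.\<close>
    then obtain q t s where f: "f = restrict q (P \<union> P')"
      and t: "restrict t (W \<union> P) \<in> V1_WP" "restrict t (W' \<union> P') \<in> V2_W'P'"
        "restrict t ?Y \<in> V_WW'MuMy"
      and q_t: "\<forall>i\<in>?Z. q i = t i"
      and s: "restrict s (W \<union> Mu) \<in> V_WMu" "restrict s (W \<union> P) \<in> V1_WP"
      and q_s: "\<forall>i\<in>P \<union> Mu. q i = s i"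
      unfolding V_PP'MuMy_iff V_PMu_iff by blast
    have s_t: "\<forall>i\<in>P \<union> Mu. s i = t i"
      using q_t q_s by (metis Un_iff)
    have "contraction (W \<union> P) V1_WP W \<subseteq>
        contraction (W \<union> (W' \<union> Mu)) (restriction V_WW'MuMy (W \<union> (W' \<union> Mu))) W"
      using contraction_le by (simp only: Un_assoc)
    moreover have "W \<union> (W' \<union> Mu) \<subseteq> ?Y"
      by blast
    moreover have "W \<inter> P = {}" "W \<inter> (W' \<union> Mu) = {}" "\<forall>i\<in>P. s i = t i"
      using disjoint s_t by (simp_all add: Int_Un_distrib)
    ultimately obtain r where r: "restrict r ?Y \<in> V_WW'MuMy" "\<forall>i\<in>W. r i = s i"
      "\<forall>i\<in>W' \<union> Mu. r i = t i" "\<forall>i. i \<notin> ?Y \<longrightarrow> r i = t i"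
      using correct_internal_values[OF subspaces(1,3) _ _ _ _ s(2) t(1,3)] by metis
    have r_P: "r i = t i" if "i \<in> P \<union> P'" for i
    proof -
      have "i \<notin> ?Y"
        using that disjoint by (auto simp: disjoint_iff)
      then show ?thesis
        using r(4) by blast
    qed
    have "restrict r (W \<union> P) = restrict s (W \<union> P)" "restrict r (W' \<union> P') = restrict t (W' \<union> P')"
      "restrict r (W \<union> Mu) = restrict s (W \<union> Mu)" "restrict q (P \<union> P') = restrict r (P \<union> P')"
      using r(2,3) r_P s_t q_t unfolding restrict_eq_restrict_iff by (simp_all add: ball_Un)
    with s t f have "restrict r (W \<union> P) \<in> V1_WP" "restrict r (W' \<union> P') \<in> V2_W'P'"
      "restrict r (W \<union> Mu) \<in> V_WMu" "f = restrict r (P \<union> P')"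
      by simp_all
    moreover have "restrict r (W \<union> W') \<in> V_WW'"
      unfolding V_WW'_iff using r(1) \<open>restrict r (W \<union> Mu) \<in> V_WMu\<close> by (intro exI[of _ r]) simp
    ultimately show ?lhs
      by blast
  qed
  also have "\<dots> \<longleftrightarrow> f \<in> V_PP'"
    unfolding V_PP' by (subst mem_restriction_intersection_iff) auto
  finally show "f \<in> matched_composition ?X ?D (W \<union> W') V_WW' \<longleftrightarrow> f \<in> V_PP'" .
qed

end
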